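(* A regular compactology $\varkappa$ on a set $S$ is generated by at least one topology on $S$ if and only if it is stable under the formation of compact inductive limits in the category of Hausdorff topological spaces.
   Context: A compactological space is a set $S$ with a class $\varkappa$ of subsets (called compacts; $\varkappa$ is called a compactology on $S$) such that: (a) $\varkappa$ covers $S$ and is upward directed by inclusion; (b) each $K\in\varkappa$ carries a compact Hausdorff topology $\tau_K$ such that, whenever $K,L\in\varkappa$ and $K\subset L$, the inclusion $K\to L$ is continuous; (c) if $H\subset L$ and $L\in\varkappa$, then the closure of $H$ in $L$ (with the topology induced from $L$) belongs to $\varkappa$. A morphism from $(S,\varkappa)$ to $\mathbb{C}$ is a function $S\to\mathbb{C}$ whose restriction to every $K\in\varkappa$ is continuous. $\varkappa$ is regular if these morphisms separate the points of $S$. A topology $\tau$ on $S$ generates $\varkappa$ if $\varkappa$ consists of exactly all $\tau$-compact subsets of $S$ (compact: every open cover has a finite subcover), each carrying the topology induced by $\tau$. $\varkappa$ is stable under the formation of compact inductive limits in the category of Hausdorff spaces if every compact Hausdorff space $(C,t)$ with $C\subset S$ that is the inductive limit (colimit), in the category of Hausdorff topological spaces and continuous maps, of some family of members $(K,\tau_K)$ of $\varkappa$ contained in $C$ (the connecting maps being the inclusions $K\to K'$ between members of the family with $K\subset K'$, and the canonical maps being the inclusions $K\to C$) belongs to $\varkappa$ (with its topology $t$). *)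

theory Defs
  imports "HOL-Analysis.Analysis"
begin

text \<open>
  The data of a compactological space are the set \<open>S\<close>, the class \<open>\<kappa>\<close> of its compacts, and the
  topology \<open>\<tau> K\<close> carried by each compact \<open>K\<close>; the values of \<open>\<tau>\<close> outside \<open>\<kappa>\<close> are irrelevant.
\<close>

definition compactology :: "'a set \<Rightarrow> 'a set set \<Rightarrow> ('a set \<Rightarrow> 'a topology) \<Rightarrow> bool" where
  "compactology S \<kappa> \<tau> \<longleftrightarrow>
     \<Union>\<kappa> = S \<and>
     (\<forall>K\<in>\<kappa>. \<forall>L\<in>\<kappa>. \<exists>M\<in>\<kappa>. K \<subseteq> M \<and> L \<subseteq> M) \<and>
     (\<forall>K\<in>\<kappa>. topspace (\<tau> K) = K \<and> compact_space (\<tau> K) \<and> Hausdorff_space (\<tau> K)) \<and>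
     (\<forall>K\<in>\<kappa>. \<forall>L\<in>\<kappa>. K \<subseteq> L \<longrightarrow> continuous_map (\<tau> K) (\<tau> L) (\<lambda>x. x)) \<and>
     (\<forall>L\<in>\<kappa>. \<forall>H. H \<subseteq> L \<longrightarrow> \<tau> L closure_of H \<in> \<kappa>)"

text \<open>Only the values of \<open>f\<close> on \<open>\<Union>\<kappa>\<close>, the underlying set, matter.\<close>

definition compactological_morphism ::
    "'a set set \<Rightarrow> ('a set \<Rightarrow> 'a topology) \<Rightarrow> ('a \<Rightarrow> complex) \<Rightarrow> bool" where
  "compactological_morphism \<kappa> \<tau> f \<longleftrightarrow> (\<forall>K\<in>\<kappa>. continuous_map (\<tau> K) euclidean f)"

definition regular_compactology ::
    "'a set \<Rightarrow> 'a set set \<Rightarrow> ('a set \<Rightarrow> 'a topology) \<Rightarrow> bool" where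
  "regular_compactology S \<kappa> \<tau> \<longleftrightarrow>
     (\<forall>x\<in>S. \<forall>y\<in>S. x \<noteq> y \<longrightarrow> (\<exists>f. compactological_morphism \<kappa> \<tau> f \<and> f x \<noteq> f y))"

definition generates_compactology ::
    "'a topology \<Rightarrow> 'a set \<Rightarrow> 'a set set \<Rightarrow> ('a set \<Rightarrow> 'a topology) \<Rightarrow> bool" where
  "generates_compactology T S \<kappa> \<tau> \<longleftrightarrow>
     topspace T = S \<and> \<kappa> = {K. compactin T K} \<and> (\<forall>K\<in>\<kappa>. \<tau> K = subtopology T K)"

text \<open>
  A family \<open>F\<close> of spaces \<open>(K, \<tau> K)\<close> is regarded as a diagram whose connecting maps are the
  inclusions \<open>K \<rightarrow> K'\<close> between members with \<open>K \<subseteq> K'\<close>.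
\<close>

definition cocone ::
    "'a set set \<Rightarrow> ('a set \<Rightarrow> 'a topology) \<Rightarrow> 'b topology \<Rightarrow> ('a set \<Rightarrow> 'a \<Rightarrow> 'b) \<Rightarrow> bool" where
  "cocone F \<tau> X f \<longleftrightarrow>
     (\<forall>K\<in>F. continuous_map (\<tau> K) X (f K)) \<and>
     (\<forall>K\<in>F. \<forall>L\<in>F. K \<subseteq> L \<longrightarrow> (\<forall>x\<in>topspace (\<tau> K). f L x = f K x))"

text \<open>
  Every cocone into \<open>X\<close> factors through the inclusions into \<open>t\<close> by exactly one continuous map.
  Maps out of \<open>t\<close> are represented by functions that are \<open>undefined\<close> off its carrier, so that
  uniqueness is uniqueness of the map on the carrier.
\<close>

definition cocones_factor_uniquely ::
    "'a set set \<Rightarrow> ('a set \<Rightarrow> 'a topology) \<Rightarrow> 'a topology \<Rightarrow> 'b topology \<Rightarrow> bool" where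
  "cocones_factor_uniquely F \<tau> t X \<longleftrightarrow>
     (\<forall>f. cocone F \<tau> X f \<longrightarrow>
        (\<exists>!g. g \<in> extensional (topspace t) \<and> continuous_map t X g \<and>
              (\<forall>K\<in>F. \<forall>x\<in>topspace (\<tau> K). g x = f K x)))"

text \<open>
  Colimit in the category of Hausdorff spaces, with inclusions as canonical maps. A definition
  cannot quantify over the type of points of the test space \<open>X\<close>. The type \<open>'a set \<times> 'a\<close> is large
  enough to contain the disjoint union of the family; the lemma
  \<open>Hausdorff_colimit_factor\<close> below shows that testing against it gives the universal property
  for Hausdorff spaces over arbitrary types.
\<close>

definition Hausdorff_colimit ::
    "'a set set \<Rightarrow> ('a set \<Rightarrow> 'a topology) \<Rightarrow> 'a topology \<Rightarrow> bool" where
  "Hausdorff_colimit F \<tau> t \<longleftrightarrow>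
     Hausdorff_space t \<and> cocone F \<tau> t (\<lambda>K x. x) \<and>
     (\<forall>X :: ('a set \<times> 'a) topology. Hausdorff_space X \<longrightarrow> cocones_factor_uniquely F \<tau> t X)"

definition stable_under_compact_inductive_limits ::
    "'a set \<Rightarrow> 'a set set \<Rightarrow> ('a set \<Rightarrow> 'a topology) \<Rightarrow> bool" where
  "stable_under_compact_inductive_limits S \<kappa> \<tau> \<longleftrightarrow>
     (\<forall>C t F. topspace t = C \<longrightarrow> C \<subseteq> S \<longrightarrow> compact_space t \<longrightarrow> Hausdorff_space t \<longrightarrow>
        F \<subseteq> \<kappa> \<longrightarrow> (\<forall>K\<in>F. K \<subseteq> C) \<longrightarrow> Hausdorff_colimit F \<tau> t \<longrightarrow>
        C \<in> \<kappa> \<and> \<tau> C = t)"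

lemma ex1_unique: "\<exists>!x. P x \<Longrightarrow> P x \<Longrightarrow> P y \<Longrightarrow> x = y"
  by blast

lemma Hausdorff_space_transport:
  fixes X :: "'b topology" and e :: "'b \<Rightarrow> 'c"
  assumes X: "Hausdorff_space X" and Y: "Y \<subseteq> topspace X" and e: "inj_on e Y"
  obtains X' :: "'c topology" where
    "Hausdorff_space X'" "continuous_map X' X (inv_into Y e)"
    "\<And>(Z :: 'd topology) h. continuous_map Z X h \<Longrightarrow> h ` topspace Z \<subseteq> Y \<Longrightarrow>
       continuous_map Z X' (\<lambda>z. e (h z))"
proof -
  define X' where "X' = pullback_topology (e ` Y) (inv_into Y e) X"
  have top: "topspace X' = e ` Y"
    using Y e by (auto simp: X'_def topspace_pullback_topology)
  have cont: "continuous_map X' X (inv_into Y e)"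
    using continuous_map_pullback[of X X id] by (simp add: X'_def)
  have "Hausdorff_space X'"
    by (rule Hausdorff_space_injective_preimage[OF X cont]) (simp add: top inj_on_inv_into)
  moreover have "continuous_map Z X' (\<lambda>z. e (h z))"
    if h: "continuous_map Z X h" "h ` topspace Z \<subseteq> Y" for Z :: "'d topology" and h
    unfolding X'_def
  proof (rule continuous_map_pullback')
    show "continuous_map Z X (inv_into Y e \<circ> (\<lambda>z. e (h z)))"
      by (rule continuous_map_eq[OF h(1)]) (use h(2) e in auto)
  qed (use h(2) in auto)
  ultimately show thesis using that[OF _ cont] by simp
qed

lemma Hausdorff_colimit_factor:
  fixes X :: "'b topology" and t :: "'a topology"
  assumes colim: "Hausdorff_colimit F \<tau> t" and F: "\<And>K. K \<in> F \<Longrightarrow> topspace (\<tau> K) = K"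
    and X: "Hausdorff_space X"
  shows "cocones_factor_uniquely F \<tau> t X"
  unfolding cocones_factor_uniquely_def
proof (intro allI impI)
  fix f assume f: "cocone F \<tau> X f"
  have sub: "K \<subseteq> topspace t" if "K \<in> F" for K
    using colim that F[OF that] continuous_map_image_subset_topspace[of "\<tau> K" t "\<lambda>x. x"]
    by (auto simp: Hausdorff_colimit_def cocone_def)
  let ?med = "\<lambda>g. g \<in> extensional (topspace t) \<and> continuous_map t X g \<and>
              (\<forall>K\<in>F. \<forall>x\<in>topspace (\<tau> K). g x = f K x)"
  have transported: "\<exists>!g. g \<in> extensional (topspace t) \<and> continuous_map t X' g \<and>
              (\<forall>K\<in>F. \<forall>x\<in>topspace (\<tau> K). g x = f' K x)"
    if "Hausdorff_space X'" "cocone F \<tau> X' f'" for X' :: "('a set \<times> 'a) topology" and f'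
  proof -
    have "cocones_factor_uniquely F \<tau> t X'"
      using colim that(1) by (simp add: Hausdorff_colimit_def)
    from this[unfolded cocones_factor_uniquely_def, THEN spec[of _ f'], THEN mp, OF that(2)]
    show ?thesis .
  qed
  have cocone_transport: "cocone F \<tau> X' (\<lambda>K x. e (f K x))"
    if that1: "\<And>(Z :: 'a topology) h. continuous_map Z X h \<Longrightarrow> h ` topspace Z \<subseteq> Y \<Longrightarrow>
         continuous_map Z X' (\<lambda>z. e (h z))"
       and that2: "\<And>K. K \<in> F \<Longrightarrow> f K ` K \<subseteq> Y"
    for X' :: "('a set \<times> 'a) topology" and e Y
    unfolding cocone_def
  proof (intro conjI ballI impI)
    have cont: "continuous_map (\<tau> K) X (f K)" if "K \<in> F" for K
      using f that unfolding cocone_def by blast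
    show "continuous_map (\<tau> K) X' (\<lambda>x. e (f K x))" if "K \<in> F" for K
      by (rule that1[of "\<tau> K" "f K"]) (use cont that2 F that in simp_all)
    show "e (f L x) = e (f K x)" if "K \<in> F" "L \<in> F" "K \<subseteq> L" "x \<in> topspace (\<tau> K)" for K L x
    proof -
      have "f L x = f K x" using f that unfolding cocone_def by blast
      then show ?thesis by (rule arg_cong)
    qed
  qed
  show "\<exists>!g. ?med g"
  proof (rule ex_ex1I)
    define Y where "Y = (\<Union>K\<in>F. f K ` K)"
    define e where "e y = (SOME p. fst p \<in> F \<and> snd p \<in> fst p \<and> f (fst p) (snd p) = y)" for y
    have e: "fst (e y) \<in> F \<and> snd (e y) \<in> fst (e y) \<and> f (fst (e y)) (snd (e y)) = y"
      if "y \<in> Y" for y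
      unfolding e_def by (rule someI_ex) (use that in \<open>auto simp: Y_def\<close>)
    have inj: "inj_on e Y" by (rule inj_on_inverseI[where g = "\<lambda>p. f (fst p) (snd p)"]) (use e in blast)
    have YX: "Y \<subseteq> topspace X"
      using f F continuous_map_image_subset_topspace unfolding cocone_def Y_def by fastforce
    obtain X' :: "('a set \<times> 'a) topology" where X': "Hausdorff_space X'"
      "continuous_map X' X (inv_into Y e)"
      "\<And>(Z :: 'a topology) h. continuous_map Z X h \<Longrightarrow> h ` topspace Z \<subseteq> Y \<Longrightarrow>
         continuous_map Z X' (\<lambda>z. e (h z))"
      by (rule Hausdorff_space_transport[OF X YX inj, where ?'d = 'a]) (rule that)
    have "cocone F \<tau> X' (\<lambda>K x. e (f K x))"
      by (rule cocone_transport[OF X'(3)]) (auto simp: Y_def)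
    from transported[OF X'(1) this] obtain g where g: "continuous_map t X' g"
      "\<And>K x. K \<in> F \<Longrightarrow> x \<in> K \<Longrightarrow> g x = e (f K x)"
      using F by auto
    have "?med (restrict (inv_into Y e \<circ> g) (topspace t))"
    proof (intro conjI ballI)
      show "continuous_map t X (restrict (inv_into Y e \<circ> g) (topspace t))"
        by (rule continuous_map_eq[OF continuous_map_compose[OF g(1) X'(2)]]) simp
      fix K x assume Kx: "K \<in> F" "x \<in> topspace (\<tau> K)"
      then have "x \<in> K" "x \<in> topspace t" "f K x \<in> Y" using F sub by (auto simp: Y_def)
      then show "restrict (inv_into Y e \<circ> g) (topspace t) x = f K x"
        using g(2) Kx inj by simp
    qed simp
    then show "\<exists>g. ?med g" by blast
  next
    fix g1 g2 assume g1: "?med g1" and g2: "?med g2"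
    let ?C = "topspace t"
    define Y where "Y = g1 ` ?C \<union> g2 ` ?C"
    define e where "e y = (if y \<in> g1 ` ?C then (UNIV :: 'a set, inv_into ?C g1 y)
      else ({}, inv_into ?C g2 y))" for y
    have inj: "inj_on e Y"
      by (rule inj_onI) (auto simp: e_def Y_def split: if_splits intro: inv_into_injective)
    have YX: "Y \<subseteq> topspace X"
      using g1 g2 continuous_map_image_subset_topspace unfolding Y_def by blast
    obtain X' :: "('a set \<times> 'a) topology" where X': "Hausdorff_space X'"
      "continuous_map X' X (inv_into Y e)"
      "\<And>(Z :: 'a topology) h. continuous_map Z X h \<Longrightarrow> h ` topspace Z \<subseteq> Y \<Longrightarrow>
         continuous_map Z X' (\<lambda>z. e (h z))"
      by (rule Hausdorff_space_transport[OF X YX inj, where ?'d = 'a]) (rule that)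
    have fY: "f K ` K \<subseteq> Y" if "K \<in> F" for K
    proof
      fix y assume "y \<in> f K ` K"
      then obtain x where "x \<in> K" "y = f K x" by blast
      then have "y = g1 x" "x \<in> ?C" using g1 that F sub by auto
      then show "y \<in> Y" by (auto simp: Y_def)
    qed
    have "cocone F \<tau> X' (\<lambda>K x. e (f K x))"
      by (rule cocone_transport[OF X'(3)]) (use fY in simp_all)
    note ex1 = transported[OF X'(1) this]
    have med: "restrict (\<lambda>x. e (g x)) ?C \<in> extensional ?C \<and>
        continuous_map t X' (restrict (\<lambda>x. e (g x)) ?C) \<and>
        (\<forall>K\<in>F. \<forall>x\<in>topspace (\<tau> K). restrict (\<lambda>x. e (g x)) ?C x = e (f K x))"
      if g: "?med g" "g ` ?C \<subseteq> Y" for g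
    proof (intro conjI ballI)
      show "continuous_map t X' (restrict (\<lambda>x. e (g x)) ?C)"
        by (rule continuous_map_eq[OF X'(3)[of t g]]) (use g in auto)
      fix K x assume "K \<in> F" "x \<in> topspace (\<tau> K)"
      then show "restrict (\<lambda>x. e (g x)) ?C x = e (f K x)"
        using g(1) F sub by auto
    qed simp
    have Y12: "g1 ` ?C \<subseteq> Y" "g2 ` ?C \<subseteq> Y" by (simp_all add: Y_def)
    have eq: "restrict (\<lambda>x. e (g1 x)) ?C = restrict (\<lambda>x. e (g2 x)) ?C"
      by (rule ex1_unique[OF ex1, OF med[OF g1 Y12(1)] med[OF g2 Y12(2)]])
    show "g1 = g2"
    proof (rule extensionalityI)
      fix x assume x: "x \<in> ?C"
      with fun_cong[OF eq, of x] have "e (g1 x) = e (g2 x)" by simp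
      then show "g1 x = g2 x" using inj x by (auto simp: Y_def dest: inj_onD)
    qed (use g1 g2 in auto)
  qed
qed

end

theory Submission
  imports Defs
begin

text \<open>
  The key object is the final topology on \<open>S\<close> with respect to the inclusions of all compacts.
  Regularity makes it Hausdorff, so each compact embeds into it as a subspace. A compact subset
  \<open>C\<close> of the final topology meets every compact in a compact, hence is the colimit of the compacts
  it contains; stability then puts \<open>C\<close> into \<open>\<kappa>\<close>, so the final topology generates \<open>\<kappa>\<close>.
  Conversely, the inclusions into the final topology form a cocone, so a compact Hausdorff colimit
  \<open>C\<close> maps into it; it does so by the inclusion, as colimits of Hausdorff spaces are covered by their
  diagrams. The final topology is finer than any generating one, whence \<open>C\<close> is compact in the latter.
\<close>

section \<open>Rigidity of compact Hausdorff topologies\<close>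

text \<open>A continuous bijection from a compact space onto a Hausdorff space is a homeomorphism;
  when the map is the identity, this forces the two topologies to be equal.\<close>

lemma compact_Hausdorff_inclusion_eq_subtopology:
  assumes "compact_space X" "Hausdorff_space Y" "continuous_map X Y (\<lambda>x. x)"
  shows "X = subtopology Y (topspace X)"
proof -
  have sub: "topspace X \<subseteq> topspace Y"
    using continuous_map_image_subset_topspace[OF assms(3)] by simp
  have "homeomorphic_map X (subtopology Y (topspace X)) id"
    by (rule continuous_imp_homeomorphic_map)
       (use assms sub in \<open>auto simp: Hausdorff_space_subtopology continuous_map_in_subtopology id_def\<close>)
  then show ?thesis by simp
qed

lemma compact_Hausdorff_topology_eq:
  assumes "compact_space X" "Hausdorff_space Y" "continuous_map X Y (\<lambda>x. x)"
    and "topspace X = topspace Y"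
  shows "X = Y"
  using compact_Hausdorff_inclusion_eq_subtopology[OF assms(1-3)] assms(4) by simp

section \<open>The final topology of the compacts\<close>

text \<open>The bound \<open>U \<subseteq> \<Union>\<kappa>\<close> pins down the carrier; the
  condition on traces alone would also admit every set disjoint from all compacts.\<close>

definition final_topology :: "'a set set \<Rightarrow> ('a set \<Rightarrow> 'a topology) \<Rightarrow> 'a topology" where
  "final_topology \<kappa> \<tau> = topology (\<lambda>U. U \<subseteq> \<Union>\<kappa> \<and> (\<forall>K\<in>\<kappa>. openin (\<tau> K) (U \<inter> K)))"

lemma openin_final_topology:
  assumes "\<And>K. K \<in> \<kappa> \<Longrightarrow> topspace (\<tau> K) = K"
  shows "openin (final_topology \<kappa> \<tau>) U \<longleftrightarrow> U \<subseteq> \<Union>\<kappa> \<and> (\<forall>K\<in>\<kappa>. openin (\<tau> K) (U \<inter> K))"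
proof -
  have "istopology (\<lambda>U. U \<subseteq> \<Union>\<kappa> \<and> (\<forall>K\<in>\<kappa>. openin (\<tau> K) (U \<inter> K)))"
    unfolding istopology_def
  proof (intro conjI allI impI ballI)
    fix U V K
    assume "U \<subseteq> \<Union>\<kappa> \<and> (\<forall>K\<in>\<kappa>. openin (\<tau> K) (U \<inter> K))"
      and "V \<subseteq> \<Union>\<kappa> \<and> (\<forall>K\<in>\<kappa>. openin (\<tau> K) (V \<inter> K))" and "K \<in> \<kappa>"
    then have "openin (\<tau> K) ((U \<inter> K) \<inter> (V \<inter> K))" by blast
    then show "openin (\<tau> K) (U \<inter> V \<inter> K)" by (simp add: Int_ac)
  next
    fix \<U> K
    assume "\<forall>U\<in>\<U>. U \<subseteq> \<Union>\<kappa> \<and> (\<forall>K\<in>\<kappa>. openin (\<tau> K) (U \<inter> K))" and "K \<in> \<kappa>"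
    then have "openin (\<tau> K) (\<Union>U\<in>\<U>. U \<inter> K)" by blast
    then show "openin (\<tau> K) (\<Union>\<U> \<inter> K)" by (simp only: Int_Union2)
  qed blast+
  then show ?thesis by (simp add: final_topology_def topology_inverse')
qed

lemma topspace_final_topology:
  assumes "\<And>K. K \<in> \<kappa> \<Longrightarrow> topspace (\<tau> K) = K"
  shows "topspace (final_topology \<kappa> \<tau>) = \<Union>\<kappa>"
proof (rule antisym)
  have "openin (\<tau> K) (\<Union>\<kappa> \<inter> K)" if "K \<in> \<kappa>" for K
  proof -
    have "\<Union>\<kappa> \<inter> K = topspace (\<tau> K)" using assms that by blast
    then show ?thesis by simp
  qed
  then have "openin (final_topology \<kappa> \<tau>) (\<Union>\<kappa>)" by (simp add: openin_final_topology assms)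
  then show "\<Union>\<kappa> \<subseteq> topspace (final_topology \<kappa> \<tau>)" by (rule openin_subset)
  show "topspace (final_topology \<kappa> \<tau>) \<subseteq> \<Union>\<kappa>"
    using openin_final_topology[OF assms, THEN iffD1, OF _ openin_topspace] by blast
qed

lemma closedin_final_topology:
  assumes "\<And>K. K \<in> \<kappa> \<Longrightarrow> topspace (\<tau> K) = K"
  shows "closedin (final_topology \<kappa> \<tau>) A \<longleftrightarrow> A \<subseteq> \<Union>\<kappa> \<and> (\<forall>K\<in>\<kappa>. closedin (\<tau> K) (A \<inter> K))"
proof -
  have "openin (\<tau> K) ((\<Union>\<kappa> - A) \<inter> K) \<longleftrightarrow> closedin (\<tau> K) (A \<inter> K)" if "K \<in> \<kappa>" for K
  proof -
    have "(\<Union>\<kappa> - A) \<inter> K = topspace (\<tau> K) - A \<inter> K" using assms that by blast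
    then show ?thesis using assms[OF that] by (simp add: closedin_def)
  qed
  then show ?thesis
    unfolding closedin_def[of "final_topology \<kappa> \<tau>"]
    by (auto simp: openin_final_topology topspace_final_topology assms)
qed

lemma continuous_map_into_final_topology:
  assumes "\<And>K. K \<in> \<kappa> \<Longrightarrow> topspace (\<tau> K) = K" and "K \<in> \<kappa>"
  shows "continuous_map (\<tau> K) (final_topology \<kappa> \<tau>) (\<lambda>x. x)"
  unfolding continuous_map_def
proof (intro conjI allI impI)
  fix U assume "openin (final_topology \<kappa> \<tau>) U"
  then have "openin (\<tau> K) (U \<inter> K)" using assms by (simp add: openin_final_topology)
  moreover have "{x \<in> topspace (\<tau> K). x \<in> U} = U \<inter> K" using assms by blast
  ultimately show "openin (\<tau> K) {x \<in> topspace (\<tau> K). x \<in> U}" by simp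
qed (use assms in \<open>auto simp: topspace_final_topology\<close>)

text \<open>The universal property of the final topology. It serves twice: for the morphisms that
  separate points, and for comparing the final topology with a generating one.\<close>

lemma continuous_map_from_final_topology:
  assumes \<tau>: "\<And>K. K \<in> \<kappa> \<Longrightarrow> topspace (\<tau> K) = K"
    and f: "\<And>K. K \<in> \<kappa> \<Longrightarrow> continuous_map (\<tau> K) X f"
  shows "continuous_map (final_topology \<kappa> \<tau>) X f"
  unfolding continuous_map_def
proof (intro conjI allI impI)
  show "f \<in> topspace (final_topology \<kappa> \<tau>) \<rightarrow> topspace X"
    using f \<tau> by (fastforce simp: topspace_final_topology continuous_map_def)
  fix U assume U: "openin X U"
  have "openin (\<tau> K) ({x \<in> \<Union>\<kappa>. f x \<in> U} \<inter> K)" if "K \<in> \<kappa>" for K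
  proof -
    have "{x \<in> \<Union>\<kappa>. f x \<in> U} \<inter> K = {x \<in> topspace (\<tau> K). f x \<in> U}" using that \<tau> by blast
    then show ?thesis using openin_continuous_map_preimage[OF f[OF that] U] by simp
  qed
  then show "openin (final_topology \<kappa> \<tau>) {x \<in> topspace (final_topology \<kappa> \<tau>). f x \<in> U}"
    using \<tau> by (auto simp: openin_final_topology topspace_final_topology)
qed

text \<open>A morphism separating two points is continuous on the final topology, so disjoint
  neighbourhoods of its two values in the complex plane pull back to disjoint neighbourhoods of the
  points.\<close>

lemma Hausdorff_final_topology:
  assumes "compactology S \<kappa> \<tau>" "regular_compactology S \<kappa> \<tau>"
  shows "Hausdorff_space (final_topology \<kappa> \<tau>)"
  unfolding Hausdorff_space_def
proof (intro allI impI)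
  have \<tau>: "topspace (\<tau> K) = K" if "K \<in> \<kappa>" for K
    using assms(1) that by (simp add: compactology_def)
  let ?T = "final_topology \<kappa> \<tau>"
  fix x y assume "x \<in> topspace ?T \<and> y \<in> topspace ?T \<and> x \<noteq> y"
  then have xy: "x \<in> topspace ?T" "y \<in> topspace ?T" "x \<noteq> y" by auto
  moreover have "topspace ?T = S"
    using assms(1) \<tau> by (simp add: topspace_final_topology compactology_def)
  ultimately obtain f where f: "compactological_morphism \<kappa> \<tau> f" "f x \<noteq> f y"
    using assms(2) unfolding regular_compactology_def by blast
  have cont: "continuous_map ?T euclidean f"
    using f(1) \<tau> by (auto simp: compactological_morphism_def intro: continuous_map_from_final_topology)
  obtain U V where UV: "open U" "open V" "f x \<in> U" "f y \<in> V" "U \<inter> V = {}"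
    using hausdorff[OF f(2)] by blast
  show "\<exists>U V. openin ?T U \<and> openin ?T V \<and> x \<in> U \<and> y \<in> V \<and> disjnt U V"
    by (rule exI[of _ "{z \<in> topspace ?T. f z \<in> U}"], rule exI[of _ "{z \<in> topspace ?T. f z \<in> V}"])
       (use UV xy openin_continuous_map_preimage[OF cont] in \<open>auto simp: disjnt_def\<close>)
qed

section \<open>Closed subsets of compacts and Hausdorff colimits\<close>

text \<open>A closed \<open>H\<close> is its own closure, so the closure axiom yields membership.
  The topology is then forced, since \<open>\<tau> H\<close> is compact and includes continuously
  into the Hausdorff space \<open>\<tau> L\<close>.\<close>

lemma compactology_closed_subset:
  assumes \<kappa>: "compactology S \<kappa> \<tau>" and L: "L \<in> \<kappa>" and H: "closedin (\<tau> L) H"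
  shows "H \<in> \<kappa>" and "\<tau> H = subtopology (\<tau> L) H"
proof -
  have \<tau>: "topspace (\<tau> K) = K" "compact_space (\<tau> K)" "Hausdorff_space (\<tau> K)" if "K \<in> \<kappa>" for K
    using \<kappa> that by (simp_all add: compactology_def)
  have HL: "H \<subseteq> L" using closedin_subset[OF H] \<tau>(1)[OF L] by simp
  have "\<tau> L closure_of H \<in> \<kappa>" using \<kappa> L HL unfolding compactology_def by blast
  then show "H \<in> \<kappa>" using H by (simp add: closure_of_closedin)
  then have "continuous_map (\<tau> H) (\<tau> L) (\<lambda>x. x)" using \<kappa> L HL unfolding compactology_def by blast
  from compact_Hausdorff_inclusion_eq_subtopology[OF _ _ this]
  show "\<tau> H = subtopology (\<tau> L) H" using \<tau> L \<open>H \<in> \<kappa>\<close> by simp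
qed

text \<open>The family also maps into the subspace \<open>\<Union>F\<close>, which gives a map
  \<open>g\<close> from \<open>t\<close> to that subspace. Viewed as a map into \<open>t\<close>,
  \<open>g\<close> mediates the same cocone as the identity, so by uniqueness it is the identity,
  and every point of \<open>t\<close> lies in \<open>\<Union>F\<close>.\<close>

lemma Hausdorff_colimit_covered:
  fixes t :: "'a topology"
  assumes colim: "Hausdorff_colimit F \<tau> t" and F: "\<And>K. K \<in> F \<Longrightarrow> topspace (\<tau> K) = K"
  shows "topspace t = \<Union>F"
proof -
  let ?D = "subtopology t (\<Union>F)"
  have t: "Hausdorff_space t" and incl: "\<And>K. K \<in> F \<Longrightarrow> continuous_map (\<tau> K) t (\<lambda>x. x)"
    using colim by (auto simp: Hausdorff_colimit_def cocone_def)
  have sub: "\<Union>F \<subseteq> topspace t"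
    using continuous_map_image_subset_topspace[OF incl] F by fastforce
  have "cocone F \<tau> ?D (\<lambda>K x. x)"
    unfolding cocone_def using incl F by (auto simp: continuous_map_in_subtopology)
  \<comment> \<open>The points of \<open>?D\<close> have type \<open>'a\<close>, whereas the
    definition of the colimit only tests spaces over \<open>'a set \<times> 'a\<close>; hence the
    transfer lemma.\<close>
  moreover have "cocones_factor_uniquely F \<tau> t ?D"
    by (rule Hausdorff_colimit_factor[OF colim F]) (simp_all add: Hausdorff_space_subtopology t)
  ultimately obtain g where g: "g \<in> extensional (topspace t)" "continuous_map t ?D g"
      "\<forall>K\<in>F. \<forall>x\<in>topspace (\<tau> K). g x = x"
    unfolding cocones_factor_uniquely_def by blast
  have "cocones_factor_uniquely F \<tau> t t" by (rule Hausdorff_colimit_factor[OF colim F t])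
  moreover have "cocone F \<tau> t (\<lambda>K x. x)" using colim by (simp add: Hausdorff_colimit_def)
  ultimately have ex1: "\<exists>!h. h \<in> extensional (topspace t) \<and> continuous_map t t h \<and>
      (\<forall>K\<in>F. \<forall>x\<in>topspace (\<tau> K). h x = x)"
    unfolding cocones_factor_uniquely_def by blast
  let ?i = "restrict (\<lambda>x. x) (topspace t)"
  have "g = ?i"
  proof (rule ex1_unique[OF ex1])
    show "g \<in> extensional (topspace t) \<and> continuous_map t t g \<and>
        (\<forall>K\<in>F. \<forall>x\<in>topspace (\<tau> K). g x = x)"
      using g by (simp add: continuous_map_in_subtopology)
    have "continuous_map t t ?i" by (rule continuous_map_eq[of _ _ "\<lambda>x. x"]) auto
    then show "?i \<in> extensional (topspace t) \<and> continuous_map t t ?i \<and>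
        (\<forall>K\<in>F. \<forall>x\<in>topspace (\<tau> K). ?i x = x)"
      using F sub by auto
  qed
  then have "topspace t \<subseteq> \<Union>F"
    using g(2) by (auto simp: continuous_map_in_subtopology image_subset_iff Pi_iff)
  with sub show ?thesis by blast
qed

text \<open>Compactness of \<open>C\<close> enters through closedness: \<open>C\<close> is closed in
  the Hausdorff final topology, so each \<open>C \<inter> K\<close> is closed in \<open>K\<close>
  and thus itself a compact of \<open>\<kappa>\<close>. These traces cover \<open>C\<close> and
  detect its closed sets, so compatible maps on them glue to a continuous map.\<close>

lemma compactin_final_topology_imp_Hausdorff_colimit:
  assumes \<kappa>: "compactology S \<kappa> \<tau>" and reg: "regular_compactology S \<kappa> \<tau>"
    and C: "compactin (final_topology \<kappa> \<tau>) C"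
  shows "Hausdorff_colimit {K \<in> \<kappa>. K \<subseteq> C} \<tau> (subtopology (final_topology \<kappa> \<tau>) C)"
proof -
  let ?T = "final_topology \<kappa> \<tau>" and ?F = "{K \<in> \<kappa>. K \<subseteq> C}"
  let ?t = "subtopology ?T C"
  have \<tau>: "topspace (\<tau> K) = K" if "K \<in> \<kappa>" for K
    using \<kappa> that by (simp add: compactology_def)
  have haus: "Hausdorff_space ?T" by (rule Hausdorff_final_topology[OF \<kappa> reg])
  have clC: "closedin ?T C" by (rule compactin_imp_closedin[OF haus C])
  then have CS: "C \<subseteq> \<Union>\<kappa>" and CK: "\<And>K. K \<in> \<kappa> \<Longrightarrow> closedin (\<tau> K) (C \<inter> K)"
    using \<tau> by (simp_all add: closedin_final_topology)
  have top: "topspace ?t = C" using CS \<tau> by (auto simp: topspace_final_topology)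
  have F: "C \<inter> K \<in> ?F" if "K \<in> \<kappa>" for K
    using compactology_closed_subset(1)[OF \<kappa> that CK[OF that]] by simp
  have factor: "cocones_factor_uniquely ?F \<tau> ?t X" for X :: "('a set \<times> 'a) topology"
    unfolding cocones_factor_uniquely_def
  proof (intro allI impI)
    fix f assume "cocone ?F \<tau> X f"
    then have cont: "continuous_map (\<tau> K) X (f K)" if "K \<in> ?F" for K
      using that unfolding cocone_def by blast
    have compat: "f L x = f K x" if "K \<in> ?F" "L \<in> ?F" "K \<subseteq> L" "x \<in> K" for K L x
    proof -
      have "x \<in> topspace (\<tau> K)" using that \<tau>[of K] by simp
      then show ?thesis using \<open>cocone ?F \<tau> X f\<close> that(1-3) unfolding cocone_def by blast
    qed
    \<comment> \<open>A cocone relates only nested members. Directedness of \<open>\<kappa>\<close>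
      gives an \<open>M\<close> above both, and \<open>C \<inter> M\<close> is an upper bound that
      still lies in the family.\<close>
    have agree: "f K x = f L x" if KL: "K \<in> ?F" "L \<in> ?F" "x \<in> K" "x \<in> L" for K L x
    proof -
      have "\<forall>K\<in>\<kappa>. \<forall>L\<in>\<kappa>. \<exists>M\<in>\<kappa>. K \<subseteq> M \<and> L \<subseteq> M"
        using \<kappa> by (simp add: compactology_def)
      then obtain M where M: "M \<in> \<kappa>" "K \<subseteq> M" "L \<subseteq> M"
        using KL(1,2) by blast
      then have "K \<subseteq> C \<inter> M" "L \<subseteq> C \<inter> M" using KL(1,2) by auto
      then have "f (C \<inter> M) x = f K x" "f (C \<inter> M) x = f L x"
        using compat F[OF M(1)] KL by blast+
      then show ?thesis by simp
    qed
    \<comment> \<open>By \<open>agree\<close> the choice of \<open>K\<close> is immaterial; the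
      restriction makes \<open>g\<close> extensional, as the definition of factorization
      demands.\<close>
    define g where "g = restrict (\<lambda>x. f (SOME K. K \<in> ?F \<and> x \<in> K) x) C"
    have g: "g x = f K x" if "K \<in> ?F" "x \<in> K" for K x
    proof -
      have "(SOME K. K \<in> ?F \<and> x \<in> K) \<in> ?F \<and> x \<in> (SOME K. K \<in> ?F \<and> x \<in> K)"
        by (rule someI_ex) (use that in blast)
      then have "f (SOME K. K \<in> ?F \<and> x \<in> K) x = f K x" using that agree by blast
      moreover have "x \<in> C" using that by blast
      ultimately show ?thesis by (simp add: g_def)
    qed
    have cover: "\<exists>K\<in>?F. x \<in> K" if "x \<in> C" for x
    proof -
      obtain K where "K \<in> \<kappa>" "x \<in> K" using \<open>x \<in> C\<close> CS by blast
      with F[of K] \<open>x \<in> C\<close> show ?thesis by blast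
    qed
    have "continuous_map ?t X g"
      unfolding continuous_map_closedin top
    proof (intro conjI ballI allI impI)
      show "g \<in> C \<rightarrow> topspace X"
      proof
        fix x assume "x \<in> C"
        then obtain K where "K \<in> ?F" "x \<in> K" using cover by blast
        then show "g x \<in> topspace X"
          using g[of K x] cont[of K] \<tau>[of K] by (auto simp: continuous_map_def)
      qed
      fix A assume A: "closedin X A"
      have "closedin (\<tau> K) ({x \<in> C. g x \<in> A} \<inter> K)" if "K \<in> \<kappa>" for K
      proof -
        \<comment> \<open>On \<open>K\<close>, the preimage of \<open>A\<close> under
          \<open>g\<close> is its preimage under the single map \<open>f (C \<inter> K)\<close>. It
          is closed in \<open>C \<inter> K\<close>, which is closed in \<open>K\<close> and carries
          the subspace topology.\<close>
        have "closedin (\<tau> (C \<inter> K)) {x \<in> topspace (\<tau> (C \<inter> K)). f (C \<inter> K) x \<in> A}"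
          by (rule closedin_continuous_map_preimage[OF cont[OF F[OF that]] A])
        moreover have "topspace (\<tau> (C \<inter> K)) = C \<inter> K" using F[OF that] \<tau> by blast
        moreover have "{x \<in> C \<inter> K. f (C \<inter> K) x \<in> A} = {x \<in> C. g x \<in> A} \<inter> K"
          using g[OF F[OF that]] by auto
        ultimately have "closedin (\<tau> (C \<inter> K)) ({x \<in> C. g x \<in> A} \<inter> K)" by simp
        then show ?thesis
          using CK[OF that] compactology_closed_subset(2)[OF \<kappa> that CK[OF that]]
          by (auto intro: closedin_trans_full)
      qed
      then have "closedin ?T {x \<in> C. g x \<in> A}" using CS \<tau> by (auto simp: closedin_final_topology)
      then show "closedin ?t {x \<in> C. g x \<in> A}" by (rule closedin_subset_topspace) blast
    qed
    then have "g \<in> extensional C \<and> continuous_map ?t X g \<and>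
        (\<forall>K\<in>?F. \<forall>x\<in>topspace (\<tau> K). g x = f K x)"
      using g \<tau> by (auto simp: g_def)
    moreover have "h = g" if h: "h \<in> extensional C \<and> continuous_map ?t X h \<and>
        (\<forall>K\<in>?F. \<forall>x\<in>topspace (\<tau> K). h x = f K x)" for h
    proof (rule extensionalityI[of _ C])
      fix x assume "x \<in> C"
      then obtain K where "K \<in> ?F" "x \<in> K" using cover by blast
      then show "h x = g x" using h g[of K x] \<tau>[of K] by simp
    qed (use h in \<open>simp_all add: g_def\<close>)
    ultimately show "\<exists>!g. g \<in> extensional (topspace ?t) \<and> continuous_map ?t X g \<and>
        (\<forall>K\<in>?F. \<forall>x\<in>topspace (\<tau> K). g x = f K x)"
      unfolding top by (rule ex1I)
  qed
  have "cocone ?F \<tau> ?t (\<lambda>K x. x)"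
    using continuous_map_into_final_topology[of \<kappa> \<tau>] \<tau>
    by (auto simp: cocone_def continuous_map_in_subtopology)
  with factor haus show ?thesis
    by (simp add: Hausdorff_colimit_def Hausdorff_space_subtopology)
qed

section \<open>The two implications\<close>

lemma stable_imp_final_topology_generates:
  assumes \<kappa>: "compactology S \<kappa> \<tau>" and reg: "regular_compactology S \<kappa> \<tau>"
    and stable: "stable_under_compact_inductive_limits S \<kappa> \<tau>"
  shows "generates_compactology (final_topology \<kappa> \<tau>) S \<kappa> \<tau>"
proof -
  let ?T = "final_topology \<kappa> \<tau>"
  have \<tau>: "topspace (\<tau> K) = K" "compact_space (\<tau> K)" if "K \<in> \<kappa>" for K
    using \<kappa> that by (simp_all add: compactology_def)
  have haus: "Hausdorff_space ?T" by (rule Hausdorff_final_topology[OF \<kappa> reg])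
  have top: "topspace ?T = S" using \<kappa> \<tau> by (simp add: topspace_final_topology compactology_def)
  have sub: "\<tau> K = subtopology ?T K" if "K \<in> \<kappa>" for K
    using compact_Hausdorff_inclusion_eq_subtopology[OF \<tau>(2)[OF that] haus
      continuous_map_into_final_topology[OF \<tau>(1) that]] \<tau>(1)[OF that] by simp
  have "compactin ?T K" if "K \<in> \<kappa>" for K
  proof -
    have "K \<subseteq> topspace ?T" using that \<tau>(1) by (auto simp: topspace_final_topology)
    then show ?thesis using sub[OF that] \<tau>(2)[OF that] by (simp add: compactin_subspace)
  qed
  moreover have "C \<in> \<kappa>" if C: "compactin ?T C" for C
  proof -
    have CS: "C \<subseteq> S" using compactin_subset_topspace[OF C] top by simp
    have "topspace (subtopology ?T C) = C" using CS top by auto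
    moreover have "compact_space (subtopology ?T C)"
      using C by (simp add: compactin_subspace)
    moreover have "Hausdorff_space (subtopology ?T C)"
      by (rule Hausdorff_space_subtopology[OF haus])
    \<comment> \<open>Stability is applied to the family of all members of \<open>\<kappa>\<close>
      contained in \<open>C\<close>.\<close>
    ultimately show ?thesis
      by (rule stable[unfolded stable_under_compact_inductive_limits_def, rule_format,
            THEN conjunct1, OF _ CS])
         (use compactin_final_topology_imp_Hausdorff_colimit[OF \<kappa> reg C] in auto)
  qed
  ultimately show ?thesis using top sub by (auto simp: generates_compactology_def)
qed

text \<open>The generating topology \<open>T\<close> is not assumed to be Hausdorff, so the
  universal property of the colimit cannot be tested against it directly. It is tested against the
  final topology, which is Hausdorff by regularity, and the result is carried over to
  \<open>T\<close> by the identity.\<close>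

lemma generates_imp_stable:
  assumes \<kappa>: "compactology S \<kappa> \<tau>" and reg: "regular_compactology S \<kappa> \<tau>"
    and T: "generates_compactology T S \<kappa> \<tau>"
  shows "stable_under_compact_inductive_limits S \<kappa> \<tau>"
  unfolding stable_under_compact_inductive_limits_def
proof (intro allI impI)
  let ?T = "final_topology \<kappa> \<tau>"
  have \<tau>: "topspace (\<tau> K) = K" "Hausdorff_space (\<tau> K)" if "K \<in> \<kappa>" for K
    using \<kappa> that by (simp_all add: compactology_def)
  fix C t F
  assume C: "topspace t = C" "compact_space t" and F: "F \<subseteq> \<kappa>"
    and colim: "Hausdorff_colimit F \<tau> t"
  have F\<tau>: "topspace (\<tau> K) = K" if "K \<in> F" for K using that F \<tau> by blast
  have "cocone F \<tau> ?T (\<lambda>K x. x)"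
    unfolding cocone_def using F \<tau>(1) continuous_map_into_final_topology[of \<kappa> \<tau>] by blast
  moreover have "cocones_factor_uniquely F \<tau> t ?T"
    by (rule Hausdorff_colimit_factor[OF colim F\<tau> Hausdorff_final_topology[OF \<kappa> reg]])
  ultimately obtain g where g: "continuous_map t ?T g"
      "\<forall>K\<in>F. \<forall>x\<in>topspace (\<tau> K). g x = x"
    unfolding cocones_factor_uniquely_def by blast
  \<comment> \<open>The cocone prescribes \<open>g\<close> only on members of \<open>F\<close>;
    since these cover \<open>t\<close>, \<open>g\<close> is the inclusion everywhere.\<close>
  have "g x = x" if "x \<in> topspace t" for x
    using g(2) that Hausdorff_colimit_covered[OF colim F\<tau>] F\<tau> by auto
  then have "continuous_map t ?T (\<lambda>x. x)" by (rule continuous_map_eq[OF g(1)])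
  moreover have "continuous_map ?T T (\<lambda>x. x)"
  proof (rule continuous_map_from_final_topology[OF \<tau>(1)])
    fix K assume "K \<in> \<kappa>"
    then have "\<tau> K = subtopology T K" using T by (simp add: generates_compactology_def)
    then show "continuous_map (\<tau> K) T (\<lambda>x. x)" by (simp add: continuous_map_from_subtopology)
  qed
  ultimately have cont: "continuous_map t T (\<lambda>x. x)"
    using continuous_map_compose by (fastforce simp: o_def)
  \<comment> \<open>\<open>C\<close> is the image of the compact space \<open>t\<close> under a
    continuous map into \<open>T\<close>, so it belongs to \<open>\<kappa>\<close> by generation. It
    remains to match \<open>t\<close> with \<open>\<tau> C\<close>.\<close>
  have "compactin T C"
    using image_compactin[OF _ cont, of C] C by (simp add: compact_space_def)
  then have mem: "C \<in> \<kappa>" and eq: "\<tau> C = subtopology T C"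
    using T by (auto simp: generates_compactology_def)
  have "continuous_map t (\<tau> C) (\<lambda>x. x)"
    using cont C by (simp add: eq continuous_map_in_subtopology)
  then have "t = \<tau> C"
    by (rule compact_Hausdorff_topology_eq[OF C(2) \<tau>(2)[OF mem]]) (simp add: C \<tau>(1)[OF mem])
  with mem show "C \<in> \<kappa> \<and> \<tau> C = t" by simp
qed

theorem theorem1p5:
  fixes S :: "'a set" and \<kappa> :: "'a set set" and \<tau> :: "'a set \<Rightarrow> 'a topology"
  assumes "compactology S \<kappa> \<tau>" and "regular_compactology S \<kappa> \<tau>"
  shows "(\<exists>T. generates_compactology T S \<kappa> \<tau>) \<longleftrightarrow>
         stable_under_compact_inductive_limits S \<kappa> \<tau>"
  using assms stable_imp_final_topology_generates generates_imp_stable by blast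

end
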